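(* Let $p,q\in\mathbb{R}[x]$ be two polynomials with degrees at most $\delta$. For any finite $A\subset\mathbb{R}$, define $$S=\{(f(p(a)),\,g(q(a))): a\in A\},$$ where each of $f,g$ is either $\log(|x|)$ or the identity function, and when a $\log$ appears $S$ is interpreted as the set of points for which the expression is defined (i.e. one restricts to those $a\in A$ with $p(a)\neq 0$ if $f=\log(|x|)$, and $q(a)\neq 0$ if $g=\log(|x|)$). If the curve $$C=\{(f(p(t)),\,g(q(t))): t\in\mathbb{R}\}$$ (where, when a $\log$ appears, $C$ is interpreted as the set of points for which the expression is defined) is not contained in an affine line, then for any finite set $T\subset\mathbb{R}^2$ we have $$|S+T|\gg_{\delta}\min\{|A||T|,\ |A|^{3/2}|T|^{1/2}\}.$$
   Context: Here $S+T=\{s+\tau: s\in S,\ \tau\in T\}$ is the sumset in $\mathbb{R}^2$, and $|X|$ denotes the cardinality of a finite set $X$ (while $|x|$ inside $\log(|x|)$ is the absolute value of a real number). The notation $X\gg_\delta Y$ means $|Y|\le K_\delta X$ for some constant $K_\delta>0$ depending on $\delta$.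
   Formalization: It is additionally assumed that S is nonempty whenever A is nonempty; otherwise the claim fails, e.g. p = x, q = x², f = log|x|, g the identity, A = {0}, T a single point gives S+T empty while the minimum is 1. *)

theory Defs
  imports
    "HOL-Analysis.Analysis"
    "HOL-Library.Set_Algebras"
    "HOL-Computational_Algebra.Polynomial"
begin

text \<open>
  The functions \<open>f\<close>, \<open>g\<close> are partial functions \<open>real \<rightharpoonup> real\<close>: the identity is \<^term>\<open>Some\<close>, and
  \<open>log(|x|)\<close> is undefined at \<open>0\<close> (the total library function has \<open>ln 0 = 0\<close>).
\<close>

definition log_abs :: "real \<rightharpoonup> real" where
  "log_abs x = (if x = 0 then None else Some (ln \<bar>x\<bar>))"

text \<open>
  The points \<open>(f(p(a)), g(q(a)))\<close>, \<open>a \<in> A\<close>, for which both coordinates are defined.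
  The set \<open>S\<close> is obtained from a finite \<open>A\<close>, the curve \<open>C\<close> from \<open>A = UNIV\<close>.
\<close>

definition poly_points ::
    "(real \<rightharpoonup> real) \<Rightarrow> (real \<rightharpoonup> real) \<Rightarrow> real poly \<Rightarrow> real poly \<Rightarrow> real set \<Rightarrow> (real \<times> real) set" where
  "poly_points f g p q A =
     {(x, y). \<exists>a\<in>A. f (poly p a) = Some x \<and> g (poly q a) = Some y}"

definition in_affine_line :: "(real \<times> real) set \<Rightarrow> bool" where
  "in_affine_line X \<longleftrightarrow> (\<exists>L. affine L \<and> aff_dim L = 1 \<and> X \<subseteq> L)"

end

theory Submission
  imports Defs
begin

text \<open>
  Outside a bounded number of exceptional parameters, the curve is a union of boundedly many arcs
  that are graphs of functions \<open>\<phi>\<close> on an interval with injective derivative; the exceptional parameters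
  are the zeros of a polynomial that vanishes identically only if the curve lies in a line. By Rolle's
  theorem two distinct translates of such an arc meet at most once. Keep the arc that contains the
  most points of \<open>S\<close>, and join consecutive points of \<open>S + T\<close> along each of its translates by \<open>T\<close>.
  This draws a simple graph with at least \<open>|T| (|S| - 1)\<close> edges and at most \<open>|T|\<^sup>2\<close> crossings on the
  vertex set \<open>S + T\<close>, and the crossing inequality (as in Szekely's proof of the Szemeredi--Trotter
  theorem) gives the bound. All edges are \<open>x\<close>-monotone, so the linear bound on the number of
  edges of a plane graph has a direct proof, without Euler's formula.
\<close>

section \<open>Plane drawings with monotone edges\<close>

abbreviation lx :: "(real \<times> real) \<times> (real \<times> real) \<Rightarrow> real" where "lx e \<equiv> fst (fst e)"
abbreviation rx :: "(real \<times> real) \<times> (real \<times> real) \<Rightarrow> real" where "rx e \<equiv> fst (snd e)"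

text \<open>An edge is the ordered pair of its left and right end, drawn as the graph of
  \<open>h e\<close> over \<open>{lx e..rx e}\<close>. As the edges form a set of pairs, there are
  no parallel edges, on which the linear bound for their number relies.\<close>

locale monotone_drawing =
  fixes V :: "(real \<times> real) set"
    and E :: "((real \<times> real) \<times> (real \<times> real)) set"
    and h :: "(real \<times> real) \<times> (real \<times> real) \<Rightarrow> real \<Rightarrow> real"
  assumes fin_V: "finite V"
    and E_sub: "E \<subseteq> V \<times> V"
    and lx_less_rx: "e \<in> E \<Longrightarrow> lx e < rx e"
    and cont: "e \<in> E \<Longrightarrow> continuous_on {lx e..rx e} (h e)"
    and h_left: "e \<in> E \<Longrightarrow> h e (lx e) = snd (fst e)"
    and h_right: "e \<in> E \<Longrightarrow> h e (rx e) = snd (snd e)"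
    and no_inner_vertex: "e \<in> E \<Longrightarrow> w \<in> V \<Longrightarrow> lx e < fst w \<Longrightarrow> fst w < rx e \<Longrightarrow> h e (fst w) \<noteq> snd w"
begin

text \<open>The strict bounds keep a shared end from counting as a crossing, whereas touching in the
  interior does count.\<close>

definition crosses where
  "crosses e e' \<longleftrightarrow> (\<exists>x. max (lx e) (lx e') < x \<and> x < min (rx e) (rx e') \<and> h e x = h e' x)"

lemma fin_E: "finite E"
  using fin_V E_sub by (meson finite_SigmaI finite_subset)

lemma on_edge_right:
  assumes "e \<in> E" "w \<in> V" "lx e < fst w" "fst w \<le> rx e" "h e (fst w) = snd w"
  shows "w = snd e"
proof -
  have "fst w = rx e" using assms no_inner_vertex[of e w] by force
  then show ?thesis using assms h_right[of e] by (simp add: prod_eq_iff)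
qed

end

locale plane_drawing = monotone_drawing +
  assumes noncrossing: "e \<in> E \<Longrightarrow> e' \<in> E \<Longrightarrow> e \<noteq> e' \<Longrightarrow> \<not> crosses e e'"
begin

section \<open>Vertical order of noncrossing edges\<close>

text \<open>Intermediate value theorem: a change of sign of the difference would produce a
  crossing.\<close>

lemma less_extends:
  assumes e: "e \<in> E" "e' \<in> E"
    and x: "max (lx e) (lx e') < x" "x < min (rx e) (rx e')" "h e x < h e' x"
    and y: "max (lx e) (lx e') < y" "y < min (rx e) (rx e')"
  shows "h e y < h e' y"
proof (rule ccontr)
  assume neg: "\<not> h e y < h e' y"
  define I where "I = {max (lx e) (lx e')<..<min (rx e) (rx e')}"
  define d where "d = (\<lambda>x. h e' x - h e x)"
  have ne: "e \<noteq> e'" using x by auto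
  have "continuous_on I (h e)" "continuous_on I (h e')"
    by (rule continuous_on_subset[OF cont]; use e in \<open>auto simp: I_def\<close>)+
  then have "connected (d ` I)"
    unfolding d_def by (intro connected_continuous_image continuous_intros) (auto simp: I_def)
  moreover have "d y \<in> d ` I" "d x \<in> d ` I" using x y by (auto simp: I_def)
  ultimately have "{d y..d x} \<subseteq> d ` I" by (rule connected_contains_Icc)
  moreover have "0 \<in> {d y..d x}" using x neg by (auto simp: d_def)
  ultimately obtain z where "z \<in> I" "d z = 0" by force
  then have "crosses e e'" unfolding crosses_def I_def d_def by force
  then show False using noncrossing e ne by auto
qed

text \<open>Continuity carries the order to the ends of the common range. Strictness can be lost
  there, since edges may share a vertex.\<close>

lemma le_at_closure:
  assumes e: "e \<in> E" "e' \<in> E"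
    and x: "max (lx e) (lx e') < x" "x < min (rx e) (rx e')" "h e x < h e' x"
    and y: "max (lx e) (lx e') \<le> y" "y \<le> min (rx e) (rx e')"
  shows "h e y \<le> h e' y"
proof -
  define a b where "a = max (lx e) (lx e')" and "b = min (rx e) (rx e')"
  have ab: "a < b" using x by (auto simp: a_def b_def)
  have cl: "closure {a<..<b} = {a..b}" using ab by simp
  have "continuous_on {a..b} (h e)" "continuous_on {a..b} (h e')"
    by (rule continuous_on_subset[OF cont]; use e in \<open>auto simp: a_def b_def\<close>)+
  then have "continuous_on (closure {a<..<b}) (\<lambda>x. h e x - h e' x)"
    unfolding cl by (intro continuous_intros)
  moreover have "y \<in> closure {a<..<b}" unfolding cl using y by (simp add: a_def b_def)
  moreover have "h e z - h e' z \<le> 0" if "z \<in> {a<..<b}" for z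
    using less_extends[OF e x, of z] that by (auto simp: a_def b_def)
  ultimately have "h e y - h e' y \<le> 0" by (rule continuous_le_on_closure)
  then show ?thesis by simp
qed

text \<open>Here \<open>y\<close> may be the right end of the common range, a case outside
  \<open>less_extends\<close>. The opposite order at \<open>x\<close> would pass to \<open>y\<close>
  by \<open>le_at_closure\<close>.\<close>

lemma less_leftwards:
  assumes e: "e \<in> E" "e' \<in> E"
    and y: "y \<le> min (rx e) (rx e')" "h e y < h e' y"
    and x: "max (lx e) (lx e') < x" "x < y"
  shows "h e x < h e' x"
proof (rule ccontr)
  assume "\<not> h e x < h e' x"
  moreover have "h e x \<noteq> h e' x"
    using noncrossing[OF e] y x unfolding crosses_def by fastforce
  ultimately have "h e' x < h e x" by simp
  then have "h e' y \<le> h e y" using le_at_closure[of e' e x y] e x y by auto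
  then show False using y by simp
qed

text \<open>The order in which the edges leave a common left end; the next lemmas show that it is a
  strict linear order on them.\<close>

definition runs_below where
  "runs_below e e' \<longleftrightarrow> fst e = fst e' \<and> (\<forall>x. lx e < x \<longrightarrow> x < min (rx e) (rx e') \<longrightarrow> h e x < h e' x)"

lemma runs_below_total:
  assumes "e \<in> E" "e' \<in> E" "fst e = fst e'" "e \<noteq> e'"
  shows "runs_below e e' \<or> runs_below e' e"
proof -
  obtain x where x: "lx e < x" "x < min (rx e) (rx e')"
    using lx_less_rx[of e] lx_less_rx[of e'] assms dense[of "lx e" "min (rx e) (rx e')"] by auto
  have "h e x \<noteq> h e' x"
    using noncrossing[of e e'] assms x unfolding crosses_def by fastforce
  then consider "h e x < h e' x" | "h e' x < h e x" by linarith
  then show ?thesis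
  proof cases
    case 1
    then have "runs_below e e'" unfolding runs_below_def using less_extends[of e e' x] x assms by auto
    then show ?thesis ..
  next
    case 2
    then have "runs_below e' e" unfolding runs_below_def using less_extends[of e' e x] x assms by auto
    then show ?thesis ..
  qed
qed

lemma runs_below_irrefl: "e \<in> E \<Longrightarrow> \<not> runs_below e e"
  using lx_less_rx[of e] dense[of "lx e" "rx e"] by (auto simp: runs_below_def)

text \<open>Close to the common left end all three edges are present. One comparison there settles
  the order of \<open>e1\<close> and \<open>e3\<close> also where \<open>e2\<close> has already
  ended.\<close>

lemma runs_below_trans:
  assumes E: "e1 \<in> E" "e2 \<in> E" "e3 \<in> E" and ab: "runs_below e1 e2" "runs_below e2 e3"
  shows "runs_below e1 e3"
proof -
  have f: "fst e1 = fst e2" "fst e2 = fst e3" using ab by (auto simp: runs_below_def)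
  obtain x where x: "lx e1 < x" "x < min (rx e1) (min (rx e2) (rx e3))"
    using lx_less_rx[OF E(1)] lx_less_rx[OF E(2)] lx_less_rx[OF E(3)] f
      dense[of "lx e1" "min (rx e1) (min (rx e2) (rx e3))"] by auto
  have "h e1 x < h e2 x" "h e2 x < h e3 x" using ab x f by (auto simp: runs_below_def)
  then have "h e1 x < h e3 x" by simp
  then show ?thesis unfolding runs_below_def using less_extends[of e1 e3 x] x E f by auto
qed

text \<open>
  An edge that is not the topmost one at its left end \<open>u\<close> spans a wedge with the next edge above it
  at \<open>u\<close>, and is charged to the leftmost vertex \<open>w\<close> of that closed wedge. No edge enters the wedge
  before \<open>w\<close>, so \<open>w\<close> together with the bit telling whether \<open>w\<close> is the right end of the edge
  determines the edge.
\<close>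

definition in_wedge where
  "in_wedge e e' w \<longleftrightarrow> w \<in> V \<and> lx e < fst w \<and> fst w \<le> min (rx e) (rx e') \<and>
     h e (fst w) \<le> snd w \<and> snd w \<le> h e' (fst w)"

text \<open>Several vertices of the wedge may share the least first coordinate; any of them may
  serve as apex.\<close>

definition wedge_apex where
  "wedge_apex e e' w \<longleftrightarrow> e' \<in> E \<and> runs_below e e' \<and> (\<forall>d\<in>E. runs_below e d \<longrightarrow> \<not> runs_below d e') \<and>
     in_wedge e e' w \<and> (\<forall>w'. in_wedge e e' w' \<longrightarrow> fst w \<le> fst w')"

text \<open>The wedge contains a vertex: the right end of whichever of its two sides ends
  first.\<close>

lemma wedge_apex_exists:
  assumes e: "e \<in> E" and "\<exists>e'\<in>E. runs_below e e'"
  shows "\<exists>e' w. wedge_apex e e' w"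
proof -
  define U where "U = {e' \<in> E. runs_below e e'}"
  have "\<exists>m\<in>U. \<forall>x\<in>U. x \<noteq> m \<longrightarrow> \<not> runs_below x m"
  proof (rule Finite_Set.bex_min_element)
    show "finite U" using fin_E by (simp add: U_def)
    show "asymp_on U runs_below"
      unfolding U_def by (rule asymp_onI) (use runs_below_trans runs_below_irrefl in blast)
    show "transp_on U runs_below"
      unfolding U_def by (rule transp_onI) (use runs_below_trans in blast)
    show "U \<noteq> {}" using assms by (auto simp: U_def)
  qed
  then obtain e' where e'U: "e' \<in> U" and minU: "\<forall>d\<in>U. d \<noteq> e' \<longrightarrow> \<not> runs_below d e'" by blast
  then have e': "e' \<in> E" "runs_below e e'" by (simp_all add: U_def)
  have min: "\<forall>d\<in>E. runs_below e d \<longrightarrow> \<not> runs_below d e'"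
  proof (intro ballI impI)
    fix d assume "d \<in> E" "runs_below e d"
    then show "\<not> runs_below d e'"
      using minU[rule_format, of d] runs_below_irrefl[OF e'(1)] by (cases "d = e'") (simp_all add: U_def)
  qed
  have f: "fst e = fst e'" using e' by (simp add: runs_below_def)
  obtain x where x: "lx e < x" "x < min (rx e) (rx e')"
    using lx_less_rx[of e] lx_less_rx[of e'] e e' f dense[of "lx e" "min (rx e) (rx e')"] by auto
  have le: "h e y \<le> h e' y" if "lx e \<le> y" "y \<le> min (rx e) (rx e')" for y
    using le_at_closure[OF e e'(1), of x y] x f e' that by (auto simp: runs_below_def)
  have "in_wedge e e' (snd e) \<or> in_wedge e e' (snd e')"
  proof (cases "rx e \<le> rx e'")
    case True
    then have "in_wedge e e' (snd e)"
      using e E_sub lx_less_rx[OF e] le[of "rx e"] h_right[OF e] by (auto simp: in_wedge_def)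
    then show ?thesis ..
  next
    case False
    then have "in_wedge e e' (snd e')"
      using e'(1) E_sub lx_less_rx[OF e'(1)] le[of "rx e'"] h_right[OF e'(1)] f
      by (auto simp: in_wedge_def)
    then show ?thesis ..
  qed
  then have "{w. in_wedge e e' w} \<noteq> {}" by blast
  moreover have "finite {w. in_wedge e e' w}"
    by (rule finite_subset[OF _ fin_V]) (auto simp: in_wedge_def)
  ultimately obtain w where "in_wedge e e' w" "\<forall>w'. in_wedge e e' w' \<longrightarrow> fst w \<le> fst w'"
    using arg_min_if_finite(1)[of "{w. in_wedge e e' w}" fst]
      arg_min_least[of "{w. in_wedge e e' w}" _ fst] by blast
  then show ?thesis using e' min unfolding wedge_apex_def by blast
qed

text \<open>The assumptions put \<open>e2\<close> inside the wedge of \<open>e1\<close> just left of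
  the apex. If \<open>e2\<close> starts right of the left end \<open>u\<close> of \<open>e1\<close>,
  its start is a vertex of the wedge left of the apex. Otherwise it must pass through
  \<open>u\<close>, hence start there, and runs strictly between two neighbouring edges.\<close>

lemma wedge_unvisited:
  assumes e: "e1 \<in> E" "e2 \<in> E" and apex: "wedge_apex e1 e1' w"
    and w2: "lx e2 < fst w" "fst w \<le> rx e2"
    and lt: "h e2 (fst w) < h e1' (fst w)"
    and x0: "max (lx e1) (lx e2) < x0" "x0 < fst w" "h e1 x0 < h e2 x0"
  shows False
proof -
  have e1': "e1' \<in> E" "fst e1' = fst e1" and wV: "w \<in> V" "lx e1 < fst w" "fst w \<le> rx e1" "fst w \<le> rx e1'"
    using apex by (auto simp: wedge_apex_def in_wedge_def runs_below_def)
  have up: "h e2 x < h e1' x" if "max (lx e1) (lx e2) < x" "x < fst w" for x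
    using less_leftwards[OF e(2) e1'(1), of "fst w" x] that lt w2 wV e1' by auto
  have up0: "h e2 x0 < h e1' x0" using up x0 by simp
  have low: "h e1 x < h e2 x" if "max (lx e1) (lx e2) < x" "x < fst w" for x
    using less_extends[OF e, of x0 x] that x0 w2 wV by auto
  have between: "h e1 x \<le> h e2 x \<and> h e2 x \<le> h e1' x" if "max (lx e1) (lx e2) \<le> x" "x < fst w" for x
    using le_at_closure[OF e, of x0 x] le_at_closure[OF e(2) e1'(1), of x0 x] that x0 up0 w2 wV e1'
    by auto
  consider "lx e1 < lx e2" | "lx e2 \<le> lx e1" by linarith
  then show False
  proof cases
    case 1
    have "in_wedge e1 e1' (fst e2)"
      using between[of "lx e2"] 1 w2 wV h_left[OF e(2)] E_sub e by (auto simp: in_wedge_def)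
    then have "fst w \<le> lx e2" using apex unfolding wedge_apex_def by blast
    then show False using w2 by simp
  next
    case 2
    \<comment> \<open>Both sides of the wedge meet at its left end, so \<open>between\<close>
      squeezes \<open>e2\<close> to that vertex.\<close>
    then have "h e2 (lx e1) = snd (fst e1)"
      using between[of "lx e1"] wV h_left[OF e(1)] h_left[OF e1'(1)] e1' by auto
    moreover have "fst e1 \<in> V" using e E_sub by auto
    ultimately have "\<not> lx e2 < lx e1"
      using no_inner_vertex[OF e(2), of "fst e1"] wV w2 by auto
    with 2 have leq: "lx e2 = lx e1" by simp
    then have feq: "fst e2 = fst e1"
      using \<open>h e2 (lx e1) = _\<close> h_left[OF e(2)] by (auto simp: prod_eq_iff)
    have "runs_below e1 e2"
      unfolding runs_below_def using less_extends[OF e, of x0] x0 w2 wV feq by auto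
    moreover have "runs_below e2 e1'"
      unfolding runs_below_def using less_extends[OF e(2) e1'(1), of x0] x0 up0 w2 wV feq e1' by auto
    ultimately show False using apex e by (auto simp: wedge_apex_def)
  qed
qed

text \<open>Just left of \<open>w\<close> one of the two edges is the lower one. The other edge
  would then lie in the wedge of the lower one, which \<open>wedge_unvisited\<close> forbids once
  strictness at \<open>w\<close> is known.\<close>

lemma wedge_apex_inj:
  assumes e: "e1 \<in> E" "e2 \<in> E" and apex: "wedge_apex e1 e1' w" "wedge_apex e2 e2' w"
    and flag: "w = snd e1 \<longleftrightarrow> w = snd e2"
  shows "e1 = e2"
proof (rule ccontr)
  assume ne: "e1 \<noteq> e2"
  have e': "e1' \<in> E" "e2' \<in> E" "fst e1' = fst e1" "fst e2' = fst e2"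
    and w: "w \<in> V" "lx e1 < fst w" "fst w \<le> rx e1" "fst w \<le> rx e1'"
       "lx e2 < fst w" "fst w \<le> rx e2" "fst w \<le> rx e2'"
       "h e1 (fst w) \<le> snd w" "h e2 (fst w) \<le> snd w" "snd w \<le> h e1' (fst w)" "snd w \<le> h e2' (fst w)"
    and ab: "runs_below e1 e1'" "runs_below e2 e2'"
    using apex by (auto simp: wedge_apex_def in_wedge_def runs_below_def)
  have ne': "snd e1' \<noteq> snd e1" "snd e2' \<noteq> snd e2"
    using ab runs_below_irrefl e e' by (metis prod.expand)+
  \<comment> \<open>This is where the bit is used. If both edges end at \<open>w\<close>, the upper
    sides miss \<open>w\<close>, as otherwise they would have the same two ends as the lower sides.
    If neither ends at \<open>w\<close>, both pass strictly below it.\<close>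
  have lt: "h e2 (fst w) < h e1' (fst w) \<and> h e1 (fst w) < h e2' (fst w)"
  proof (cases "w = snd e1")
    case True
    then have "w = snd e2" using flag by simp
    have "h e1' (fst w) \<noteq> snd w" "h e2' (fst w) \<noteq> snd w"
      using on_edge_right[OF e'(1) w(1)] on_edge_right[OF e'(2) w(1)] w e' ne' True \<open>w = snd e2\<close>
      by auto
    then show ?thesis using w by auto
  next
    case False
    then have "h e1 (fst w) \<noteq> snd w" "h e2 (fst w) \<noteq> snd w"
      using on_edge_right[OF e(1) w(1)] on_edge_right[OF e(2) w(1)] w flag by auto
    then show ?thesis using w by auto
  qed
  obtain x where x: "max (lx e1) (lx e2) < x" "x < fst w"
    using w dense[of "max (lx e1) (lx e2)" "fst w"] by auto
  have "h e1 x \<noteq> h e2 x"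
    using noncrossing[OF e ne] x w unfolding crosses_def by fastforce
  then consider "h e1 x < h e2 x" | "h e2 x < h e1 x" by linarith
  then show False
  proof cases
    case 1
    then show False using wedge_unvisited[OF e apex(1), of x] w lt x by auto
  next
    case 2
    then show False using wedge_unvisited[OF e(2,1) apex(2), of x] w lt x by auto
  qed
qed

text \<open>One summand \<open>card V\<close> counts the topmost edges, at most one per left end;
  the other two come from charging the remaining edges injectively to a vertex and a bit.\<close>

theorem card_edges_le: "card E \<le> 3 * card V"
proof -
  define L where "L = {e \<in> E. \<exists>e'\<in>E. runs_below e e'}"
  have "inj_on fst (E - L)"
  proof (rule inj_onI)
    fix e e' assume "e \<in> E - L" "e' \<in> E - L" "fst e = fst e'"
    then show "e = e'" using runs_below_total[of e e'] by (auto simp: L_def)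
  qed
  moreover have "fst ` (E - L) \<subseteq> V" using E_sub by auto
  ultimately have top: "card (E - L) \<le> card V"
    using fin_V by (rule card_inj_on_le)
  have "\<forall>e\<in>L. \<exists>w. \<exists>e'. wedge_apex e e' w"
    using wedge_apex_exists unfolding L_def by blast
  then obtain w where w: "\<And>e. e \<in> L \<Longrightarrow> \<exists>e'. wedge_apex e e' (w e)"
    by metis
  define c where "c = (\<lambda>e. (w e, w e = snd e))"
  have "inj_on c L"
  proof (rule inj_onI)
    fix e1 e2 assume L: "e1 \<in> L" "e2 \<in> L" and eq: "c e1 = c e2"
    obtain e1' e2' where "wedge_apex e1 e1' (w e1)" "wedge_apex e2 e2' (w e1)"
      using w[OF L(1)] w[OF L(2)] eq by (auto simp: c_def)
    then show "e1 = e2"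
      by (rule wedge_apex_inj[rotated 2]) (use L eq in \<open>auto simp: L_def c_def\<close>)
  qed
  moreover have "c ` L \<subseteq> V \<times> UNIV"
    using w by (fastforce simp: c_def wedge_apex_def in_wedge_def)
  ultimately have "card L \<le> card (V \<times> (UNIV :: bool set))"
    using fin_V by (intro card_inj_on_le) auto
  then have "card L \<le> 2 * card V" by (simp add: card_cartesian_product)
  moreover have "card E = card (E - L) + card L"
  proof -
    have "L \<subseteq> E" by (auto simp: L_def)
    then show ?thesis using fin_E by (metis card_Diff_subset card_mono finite_subset le_add_diff_inverse2)
  qed
  ultimately show ?thesis using top by simp
qed

end

section \<open>The crossing inequality\<close>

text \<open>The probability of \<open>W\<close> when each point of \<open>V\<close> is kept independently with probability \<open>p\<close>.\<close>

definition sample_weight :: "real \<Rightarrow> 'a set \<Rightarrow> 'a set \<Rightarrow> real" where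
  "sample_weight p V W = (\<Prod>v\<in>W. p) * (\<Prod>v\<in>V - W. 1 - p)"

lemma sample_weight_nonneg: "0 \<le> p \<Longrightarrow> p \<le> 1 \<Longrightarrow> 0 \<le> sample_weight p V W"
  unfolding sample_weight_def by (intro mult_nonneg_nonneg prod_nonneg) auto

text \<open>The probability that all of \<open>F\<close> is kept. Expanding the product of
  \<open>p + g v\<close> over \<open>V\<close> gives a sum over all subsets, and
  \<open>g = 0\<close> on \<open>F\<close> removes those that miss a point of
  \<open>F\<close>.\<close>

lemma sum_sample_weight_superset:
  assumes V: "finite V" and F: "F \<subseteq> V"
  shows "(\<Sum>W\<in>Pow V. if F \<subseteq> W then sample_weight p V W else 0) = p ^ card F"
proof -
  define g where "g = (\<lambda>v. if v \<in> F then 0 else 1 - p)"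
  have "(\<Sum>W\<in>Pow V. if F \<subseteq> W then sample_weight p V W else 0) =
        (\<Sum>W\<in>Pow V. (\<Prod>v\<in>W. p) * (\<Prod>v\<in>V - W. g v))"
  proof (rule sum.cong[OF refl])
    fix W assume W: "W \<in> Pow V"
    show "(if F \<subseteq> W then sample_weight p V W else 0) = (\<Prod>v\<in>W. p) * (\<Prod>v\<in>V - W. g v)"
    proof (cases "F \<subseteq> W")
      case True
      then have "(\<Prod>v\<in>V - W. g v) = (\<Prod>v\<in>V - W. 1 - p)"
        by (intro prod.cong) (auto simp: g_def)
      then show ?thesis using True by (simp add: sample_weight_def)
    next
      case False
      then have "(\<Prod>v\<in>V - W. g v) = 0"
        using F V by (intro prod_zero) (auto simp: g_def)
      then show ?thesis using False by simp
    qed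
  qed
  also have "\<dots> = (\<Prod>v\<in>V. p + g v)" by (rule prod_add[OF V, symmetric])
  also have "\<dots> = (\<Prod>v\<in>V. if v \<in> F then p else 1)"
    by (intro prod.cong) (auto simp: g_def)
  also have "\<dots> = (\<Prod>v\<in>F. p)"
    using V F by (simp add: prod.If_cases Int_absorb1)
  finally show ?thesis by simp
qed

text \<open>Linearity of expectation, for the number of configurations \<open>d\<close> whose
  vertices \<open>F d\<close> all survive.\<close>

lemma sum_sample_weight_card:
  assumes V: "finite V" and D: "finite D"
    and F: "\<And>d. d \<in> D \<Longrightarrow> F d \<subseteq> V" "\<And>d. d \<in> D \<Longrightarrow> card (F d) = k"
  shows "(\<Sum>W\<in>Pow V. sample_weight p V W * real (card {d \<in> D. F d \<subseteq> W})) = p ^ k * real (card D)"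
proof -
  have "(\<Sum>W\<in>Pow V. sample_weight p V W * real (card {d \<in> D. F d \<subseteq> W})) =
        (\<Sum>W\<in>Pow V. \<Sum>d\<in>D. if F d \<subseteq> W then sample_weight p V W else 0)"
    by (intro sum.cong refl) (simp add: D sum.If_cases Int_def)
  also have "\<dots> = (\<Sum>d\<in>D. \<Sum>W\<in>Pow V. if F d \<subseteq> W then sample_weight p V W else 0)"
    by (rule sum.swap)
  also have "\<dots> = (\<Sum>d\<in>D. p ^ k)"
    by (intro sum.cong refl) (simp only: sum_sample_weight_superset[OF V F(1)] F(2))
  finally show ?thesis by simp
qed

context monotone_drawing
begin

text \<open>Ordered pairs, so every crossing pair of edges is counted twice.\<close>

definition crossings where
  "crossings = {(e, e'). e \<in> E \<and> e' \<in> E \<and> e \<noteq> e' \<and> crosses e e'}"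

definition ends :: "(real \<times> real) \<times> (real \<times> real) \<Rightarrow> (real \<times> real) set" where
  "ends e = {fst e, snd e}"

lemma fin_crossings: "finite crossings"
  by (rule finite_subset[of _ "E \<times> E"]) (auto simp: crossings_def fin_E)

lemma card_ends: "e \<in> E \<Longrightarrow> card (ends e) = 2"
  using lx_less_rx[of e] by (auto simp: ends_def card_insert_if)

lemma ends_sub: "e \<in> E \<Longrightarrow> ends e \<subseteq> V"
  using E_sub by (auto simp: ends_def)

text \<open>Deleting the first edge of every surviving crossing leaves a plane drawing on
  \<open>W\<close>, to which the linear bound applies.\<close>

lemma induced_card_le:
  assumes W: "W \<subseteq> V"
  shows "card {e \<in> E. ends e \<subseteq> W}
    \<le> 3 * card W + card {c \<in> crossings. ends (fst c) \<union> ends (snd c) \<subseteq> W}"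
proof -
  define X where "X = {c \<in> crossings. ends (fst c) \<union> ends (snd c) \<subseteq> W}"
  define E' where "E' = {e \<in> E. ends e \<subseteq> W} - fst ` X"
  have finX: "finite X" using fin_crossings by (simp add: X_def)
  have fW: "finite W" using W fin_V finite_subset by blast
  interpret W: monotone_drawing W E' h
  proof (unfold_locales)
    show "E' \<subseteq> W \<times> W" by (force simp: E'_def ends_def)
  qed (use fW lx_less_rx cont h_left h_right no_inner_vertex W in \<open>auto simp: E'_def\<close>)
  interpret W: plane_drawing W E' h
  proof (unfold_locales)
    fix e e' assume e: "e \<in> E'" "e' \<in> E'" "e \<noteq> e'"
    show "\<not> W.crosses e e'"
    proof
      assume "W.crosses e e'"
      then have "(e, e') \<in> X"
        using e by (auto simp: X_def crossings_def E'_def crosses_def W.crosses_def)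
      then show False using e by (force simp: E'_def)
    qed
  qed
  have "card {e \<in> E. ends e \<subseteq> W} \<le> card (E' \<union> fst ` X)"
    using W.fin_E finX by (intro card_mono) (auto simp: E'_def)
  also have "\<dots> \<le> card E' + card (fst ` X)" by (rule card_Un_le)
  also have "\<dots> \<le> 3 * card W + card X"
    using W.card_edges_le card_image_le[OF finX, of fst] by linarith
  finally show ?thesis by (simp add: X_def)
qed

text \<open>The expectation of \<open>induced_card_le\<close> over a random \<open>W\<close>. The
  exponent 4 needs the ends of crossing edges to be four distinct points, hence
  \<open>indep\<close>.\<close>

lemma sampled_crossing_inequality:
  assumes p: "0 \<le> p" "p \<le> 1"
    and indep: "\<And>e e'. (e, e') \<in> crossings \<Longrightarrow> ends e \<inter> ends e' = {}"
  shows "p ^ 2 * real (card E) \<le> 3 * p * real (card V) + p ^ 4 * real (card crossings)"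
proof -
  let ?w = "sample_weight p V"
  have card4: "card (ends (fst c) \<union> ends (snd c)) = 4" if "c \<in> crossings" for c
    using that indep[of "fst c" "snd c"] card_ends[of "fst c"] card_ends[of "snd c"]
    by (subst card_Un_disjoint) (auto simp: crossings_def ends_def)
  have sub4: "ends (fst c) \<union> ends (snd c) \<subseteq> V" if "c \<in> crossings" for c
    using that ends_sub[of "fst c"] ends_sub[of "snd c"] by (auto simp: crossings_def)
  have "p ^ 2 * real (card E) = (\<Sum>W\<in>Pow V. ?w W * real (card {e \<in> E. ends e \<subseteq> W}))"
    using sum_sample_weight_card[OF fin_V fin_E ends_sub card_ends] by simp
  also have "\<dots> \<le> (\<Sum>W\<in>Pow V. ?w W * real (3 * card W +
        card {c \<in> crossings. ends (fst c) \<union> ends (snd c) \<subseteq> W}))"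
  proof (intro sum_mono mult_left_mono sample_weight_nonneg p)
    fix W assume "W \<in> Pow V"
    then show "real (card {e \<in> E. ends e \<subseteq> W}) \<le> real (3 * card W +
        card {c \<in> crossings. ends (fst c) \<union> ends (snd c) \<subseteq> W})"
      using induced_card_le[of W] by (simp only: of_nat_le_iff Pow_iff)
  qed
  also have "\<dots> = 3 * (\<Sum>W\<in>Pow V. ?w W * real (card W)) +
        (\<Sum>W\<in>Pow V. ?w W * real (card {c \<in> crossings. ends (fst c) \<union> ends (snd c) \<subseteq> W}))"
    by (simp add: distrib_left sum.distrib sum_distrib_left mult_ac)
  also have "(\<Sum>W\<in>Pow V. ?w W * real (card W)) =
      (\<Sum>W\<in>Pow V. ?w W * real (card {v \<in> V. {v} \<subseteq> W}))"
  proof (intro sum.cong refl)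
    fix W assume "W \<in> Pow V"
    then have "{v \<in> V. {v} \<subseteq> W} = W" by auto
    then show "?w W * real (card W) = ?w W * real (card {v \<in> V. {v} \<subseteq> W})" by simp
  qed
  also have "\<dots> = p ^ 1 * real (card V)"
    by (rule sum_sample_weight_card[OF fin_V fin_V]) auto
  also have "(\<Sum>W\<in>Pow V. ?w W * real (card {c \<in> crossings. ends (fst c) \<union> ends (snd c) \<subseteq> W}))
      = p ^ 4 * real (card crossings)"
    by (rule sum_sample_weight_card[OF fin_V fin_crossings sub4 card4])
  finally show ?thesis by simp
qed

theorem crossing_inequality:
  assumes indep: "\<And>e e'. (e, e') \<in> crossings \<Longrightarrow> ends e \<inter> ends e' = {}"
    and many: "4 * card V \<le> card E"
  shows "card E ^ 3 \<le> 64 * card V ^ 2 * card crossings"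
proof (cases "card E = 0")
  case False
  define v e x where "v = real (card V)" and "e = real (card E)" and "x = real (card crossings)"
  have "V \<noteq> {}" using False E_sub by auto
  then have v: "v > 0" using fin_V by (simp add: v_def card_gt_0_iff)
  have e: "e > 0" "4 * v \<le> e" using False many by (auto simp: e_def v_def)
  \<comment> \<open>With this \<open>p\<close> the left side \<open>p^2 * e\<close> equals
    \<open>4 * p * v\<close> and exceeds the vertex term \<open>3 * p * v\<close> by
    \<open>p * v\<close>; \<open>many\<close> makes \<open>p\<close> at most 1.\<close>
  define p where "p = 4 * v / e"
  have p: "0 < p" "p \<le> 1" using e v by (auto simp: p_def)
  have pe: "p * e = 4 * v" using e by (simp add: p_def)
  have "p ^ 2 * e \<le> 3 * p * v + p ^ 4 * x"
    using sampled_crossing_inequality[of p] p indep by (simp add: v_def e_def x_def)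
  moreover have "p ^ 2 * e = p * (4 * v)" by (simp add: power2_eq_square pe[symmetric])
  moreover have "p ^ 4 * x = p * (p ^ 3 * x)" by (simp add: power_numeral_reduce)
  ultimately have "p * v \<le> p * (p ^ 3 * x)" by linarith
  then have "v \<le> p ^ 3 * x" using p by simp
  then have "v * e ^ 3 \<le> p ^ 3 * x * e ^ 3" using e by (intro mult_right_mono) auto
  also have "\<dots> = (p * e) ^ 3 * x" by (simp add: power_mult_distrib)
  also have "\<dots> = v * (64 * v ^ 2 * x)" unfolding pe by (simp add: power_numeral_reduce)
  finally have "e ^ 3 \<le> 64 * v ^ 2 * x" using v by simp
  then have "real (card E ^ 3) \<le> real (64 * card V ^ 2 * card crossings)"
    by (simp add: v_def e_def x_def)
  then show ?thesis by (simp only: of_nat_le_iff)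
qed simp

end

section \<open>Translates of a curve\<close>

text \<open>The curve is the graph of \<open>\<phi>\<close> over \<open>J\<close>, \<open>T\<close>
  holds the translation vectors, and \<open>P\<close> will be the sumset. In
  \<open>meet_once\<close> the curve is compared with its own translate by
  \<open>(a, b)\<close>.\<close>

locale curve_translates =
  fixes J :: "real set" and \<phi> :: "real \<Rightarrow> real" and P T :: "(real \<times> real) set"
  assumes fin_P: "finite P" and fin_T: "finite T"
    and interval_J: "is_interval J"
    and cont_\<phi>: "continuous_on J \<phi>"
    and meet_once: "\<lbrakk>x \<in> J; x - a \<in> J; y \<in> J; y - a \<in> J; \<phi> x = \<phi> (x - a) + b; \<phi> y = \<phi> (y - a) + b;
       (a, b) \<noteq> (0, 0)\<rbrakk> \<Longrightarrow> x = y"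
begin

definition on_translate :: "real \<times> real \<Rightarrow> real \<times> real \<Rightarrow> bool" where
  "on_translate t z \<longleftrightarrow> fst z - fst t \<in> J \<and> snd z = \<phi> (fst z - fst t) + snd t"

lemma translates_meet_once:
  assumes "on_translate t z" "on_translate t' z" "on_translate t z'" "on_translate t' z'" "t \<noteq> t'"
  shows "z = z'"
proof -
  have "fst z - fst t = fst z' - fst t"
  proof (rule meet_once)
    let ?a = "fst t' - fst t" and ?b = "snd t' - snd t"
    show "(?a, ?b) \<noteq> (0, 0)" using assms(5) by (auto simp: prod_eq_iff)
    show "\<phi> (fst z - fst t) = \<phi> (fst z - fst t - ?a) + ?b"
      and "\<phi> (fst z' - fst t) = \<phi> (fst z' - fst t - ?a) + ?b"
      using assms by (auto simp: on_translate_def algebra_simps)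
  qed (use assms in \<open>auto simp: on_translate_def\<close>)
  then have "fst z = fst z'" by simp
  then show ?thesis using assms by (auto simp: on_translate_def prod_eq_iff)
qed

text \<open>Every point of \<open>P\<close> on the translate counts, also one that arises from
  another translate; hence no arc passes through a vertex.\<close>

definition consecutive where
  "consecutive t u v \<longleftrightarrow> u \<in> P \<and> v \<in> P \<and> fst u < fst v \<and> on_translate t u \<and> on_translate t v \<and>
     (\<forall>w\<in>P. on_translate t w \<longrightarrow> \<not> (fst u < fst w \<and> fst w < fst v))"

definition E where "E = {(u, v). \<exists>t\<in>T. consecutive t u v}"

text \<open>The choice is in fact forced, because two distinct translates do not share two
  points.\<close>

definition carrier_of where
  "carrier_of e = (SOME t. t \<in> T \<and> consecutive t (fst e) (snd e))"

definition arc where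
  "arc e x = \<phi> (x - fst (carrier_of e)) + snd (carrier_of e)"

lemma carrier_of:
  assumes "e \<in> E"
  shows "carrier_of e \<in> T" "consecutive (carrier_of e) (fst e) (snd e)"
proof -
  have "\<exists>t. t \<in> T \<and> consecutive t (fst e) (snd e)" using assms unfolding E_def by fastforce
  then have "carrier_of e \<in> T \<and> consecutive (carrier_of e) (fst e) (snd e)"
    unfolding carrier_of_def by (rule someI_ex)
  then show "carrier_of e \<in> T" "consecutive (carrier_of e) (fst e) (snd e)" by auto
qed

lemma arc_domain:
  assumes "e \<in> E" "lx e \<le> x" "x \<le> rx e"
  shows "x - fst (carrier_of e) \<in> J"
proof -
  let ?t = "fst (carrier_of e)"
  have "lx e - ?t \<in> J" "rx e - ?t \<in> J"
    using carrier_of(2)[OF assms(1)] by (simp_all add: consecutive_def on_translate_def)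
  moreover have "lx e - ?t \<le> x - ?t" "x - ?t \<le> rx e - ?t" using assms by simp_all
  ultimately show ?thesis by (rule mem_is_interval_1_I[OF interval_J])
qed

lemma on_arc:
  "e \<in> E \<Longrightarrow> lx e \<le> x \<Longrightarrow> x \<le> rx e \<Longrightarrow> on_translate (carrier_of e) (x, arc e x)"
  using arc_domain[of e x] by (simp add: on_translate_def arc_def)

sublocale monotone_drawing P E arc
proof
  show "finite P" by (rule fin_P)
  show "E \<subseteq> P \<times> P" by (auto simp: E_def consecutive_def)
  fix e assume e: "e \<in> E"
  note c = carrier_of(2)[OF e]
  show lr: "lx e < rx e" using c by (simp add: consecutive_def)
  show "arc e (lx e) = snd (fst e)" "arc e (rx e) = snd (snd e)"
    using c by (auto simp: consecutive_def on_translate_def arc_def)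
  show "continuous_on {lx e..rx e} (arc e)"
    unfolding arc_def
    by (intro continuous_on_add continuous_on_const continuous_on_compose2[OF cont_\<phi>]
        continuous_on_diff continuous_on_id image_subsetI arc_domain[OF e]) auto
  fix w assume w: "w \<in> P" "lx e < fst w" "fst w < rx e"
  show "arc e (fst w) \<noteq> snd w"
  proof
    assume "arc e (fst w) = snd w"
    then have "on_translate (carrier_of e) w" using on_arc[OF e, of "fst w"] w by simp
    then show False using c w by (auto simp: consecutive_def)
  qed
qed

text \<open>On one translate, an end of one arc cannot lie strictly inside another, so arcs that
  overlap have the same ends.\<close>

lemma same_carrier_eq:
  assumes e: "e \<in> E" "e' \<in> E" "carrier_of e = carrier_of e'"
    and x: "lx e < x" "x < rx e" and y: "lx e' < x" "x < rx e'"
  shows "e = e'"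
proof -
  note c = carrier_of(2)[OF e(1)] carrier_of(2)[OF e(2), folded e(3)]
  have "lx e = lx e'" "rx e = rx e'"
    using c x y unfolding consecutive_def by (meson less_trans linorder_neqE)+
  then show ?thesis using c by (auto simp: consecutive_def on_translate_def prod_eq_iff)
qed

lemma crossing_point:
  assumes "(e, e') \<in> crossings"
  obtains z where "lx e < fst z" "fst z < rx e" "lx e' < fst z" "fst z < rx e'"
    "on_translate (carrier_of e) z" "on_translate (carrier_of e') z"
    "carrier_of e \<noteq> carrier_of e'"
proof -
  have e: "e \<in> E" "e' \<in> E" "e \<noteq> e'" using assms by (auto simp: crossings_def)
  obtain x where x: "lx e < x" "x < rx e" "lx e' < x" "x < rx e'" "arc e x = arc e' x"
    using assms by (auto simp: crossings_def crosses_def)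
  have "carrier_of e \<noteq> carrier_of e'" using same_carrier_eq[OF e(1,2)] e(3) x by blast
  with x show ?thesis using on_arc[OF e(1), of x] on_arc[OF e(2), of x] that[of "(x, arc e x)"] by simp
qed

text \<open>A shared end would be a second common point of the two translates, besides the crossing
  itself.\<close>

lemma crossing_ends_disjoint:
  assumes "(e, e') \<in> crossings"
  shows "ends e \<inter> ends e' = {}"
proof (rule ccontr)
  assume "ends e \<inter> ends e' \<noteq> {}"
  then obtain u where u: "u \<in> ends e" "u \<in> ends e'" by auto
  obtain z where z: "lx e < fst z" "fst z < rx e"
    "on_translate (carrier_of e) z" "on_translate (carrier_of e') z" "carrier_of e \<noteq> carrier_of e'"
    using crossing_point[OF assms] by metis
  have "on_translate (carrier_of e) u" "on_translate (carrier_of e') u"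
    using u assms carrier_of(2)[of e] carrier_of(2)[of e']
    by (auto simp: crossings_def ends_def consecutive_def)
  then have "u = z" using translates_meet_once z by blast
  then show False using u z by (auto simp: ends_def)
qed

text \<open>The two translates determine the crossing: they meet in one point, and on each of them
  only one arc has it in its interior.\<close>

lemma card_crossings_le: "card crossings \<le> card T ^ 2"
proof -
  define c where "c = (\<lambda>(e, e'). (carrier_of e, carrier_of e'))"
  have "inj_on c crossings"
  proof (rule inj_onI, clarify)
    fix e1 e1' e2 e2'
    assume X: "(e1, e1') \<in> crossings" "(e2, e2') \<in> crossings" and eq: "c (e1, e1') = c (e2, e2')"
    have eqs: "carrier_of e1 = carrier_of e2" "carrier_of e1' = carrier_of e2'"
      using eq by (auto simp: c_def)
    obtain z where z: "lx e1 < fst z" "fst z < rx e1" "lx e1' < fst z" "fst z < rx e1'"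
        "on_translate (carrier_of e1) z" "on_translate (carrier_of e1') z"
        "carrier_of e1 \<noteq> carrier_of e1'"
      using crossing_point[OF X(1)] .
    obtain y where y: "lx e2 < fst y" "fst y < rx e2" "lx e2' < fst y" "fst y < rx e2'"
        "on_translate (carrier_of e1) y" "on_translate (carrier_of e1') y"
      using crossing_point[OF X(2)] unfolding eqs by metis
    have "y = z" using translates_meet_once y z by blast
    then show "e1 = e2 \<and> e1' = e2'"
      using same_carrier_eq[of e1 e2 "fst z"] same_carrier_eq[of e1' e2' "fst z"] eqs y z X
      by (auto simp: crossings_def)
  qed
  moreover have "c ` crossings \<subseteq> T \<times> T"
    using carrier_of(1) by (auto simp: c_def crossings_def)
  ultimately have "card crossings \<le> card (T \<times> T)"
    using fin_T by (intro card_inj_on_le) auto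
  then show ?thesis by (simp add: card_cartesian_product power2_eq_square)
qed

lemma consecutive_exists:
  assumes "u \<in> P" "v \<in> P" "on_translate t u" "on_translate t v" "fst u < fst v"
  shows "\<exists>w. consecutive t u w"
proof -
  define Q where "Q = {w \<in> P. on_translate t w \<and> fst u < fst w}"
  have fin: "finite Q" and ne: "Q \<noteq> {}" using fin_P assms unfolding Q_def by (simp, blast)
  define w where "w = arg_min_on fst Q"
  have "w \<in> Q" "\<not> (\<exists>x\<in>Q. fst x < fst w)"
    using arg_min_if_finite[OF fin ne, of fst] by (auto simp: w_def)
  then have "consecutive t u w" using assms by (auto simp: Q_def consecutive_def)
  then show ?thesis ..
qed

text \<open>On each translate every \<open>s + t\<close> has a successor unless \<open>s\<close> is
  the rightmost point \<open>m\<close> of \<open>S\<close>. Edges for different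
  \<open>(s, t)\<close> differ, because two points determine \<open>t\<close> and then
  \<open>s\<close>.\<close>

lemma card_edges_ge:
  assumes S: "finite S" "\<And>s. s \<in> S \<Longrightarrow> fst s \<in> J \<and> snd s = \<phi> (fst s)" and ST: "S + T \<subseteq> P"
  shows "(card S - 1) * card T \<le> card E"
proof (cases "S = {}")
  case False
  have "Max (fst ` S) \<in> fst ` S" using S(1) False by (intro Max_in) auto
  then obtain m where m: "m \<in> S" "Max (fst ` S) = fst m" by auto
  have max: "fst s \<le> fst m" if "s \<in> S" for s
    using that S(1) m(2) by (metis Max_ge finite_imageI imageI)
  have less: "fst s < fst m" if "s \<in> S - {m}" for s
    using that max[of s] S(2)[of s] S(2)[OF m(1)] by (auto simp: prod_eq_iff order_less_le)
  have on: "s + t \<in> P" "on_translate t (s + t)" if "s \<in> S" "t \<in> T" for s t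
    using that ST S(2)[of s] by (auto simp: on_translate_def set_plus_def)
  have "\<exists>w. consecutive t (s + t) w" if "s \<in> S - {m}" "t \<in> T" for s t
    using consecutive_exists[OF on(1)[of s t] on(1)[OF m(1), of t] on(2)[of s t] on(2)[OF m(1), of t]]
      that less[of s] by auto
  then obtain nxt where nxt: "\<And>s t. s \<in> S - {m} \<Longrightarrow> t \<in> T \<Longrightarrow> consecutive t (s + t) (nxt s t)"
    by metis
  define c where "c = (\<lambda>(s, t). (s + t, nxt s t))"
  have "inj_on c ((S - {m}) \<times> T)"
  proof (rule inj_onI)
    fix x y assume x: "x \<in> (S - {m}) \<times> T" and y: "y \<in> (S - {m}) \<times> T" and eq: "c x = c y"
    obtain s t s' t' where xy: "x = (s, t)" "y = (s', t')" by (metis surj_pair)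
    have s: "s \<in> S" "s \<noteq> m" "s' \<in> S" "s' \<noteq> m" and t: "t \<in> T" "t' \<in> T"
      using x y xy by auto
    have eqs: "s + t = s' + t'" "nxt s t = nxt s' t'" using eq xy by (auto simp: c_def)
    have "consecutive t (s + t) (nxt s t)" "consecutive t' (s + t) (nxt s t)"
      using nxt[of s t] nxt[of s' t'] s t eqs by auto
    then have "t = t'"
      using translates_meet_once[of t "s + t" t' "nxt s t"]
      unfolding consecutive_def by (metis less_irrefl)
    then show "x = y" using eqs xy by simp
  qed
  moreover have "c ` ((S - {m}) \<times> T) \<subseteq> E"
  proof (rule image_subsetI)
    fix x assume x: "x \<in> (S - {m}) \<times> T"
    obtain s t where st: "x = (s, t)" by (metis surj_pair)
    then have "consecutive t (s + t) (nxt s t)" "t \<in> T" using x nxt[of s t] by auto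
    then show "c x \<in> E" unfolding E_def c_def st prod.case mem_Collect_eq by blast
  qed
  ultimately have "card ((S - {m}) \<times> T) \<le> card E" using fin_E by (rule card_inj_on_le)
  then show ?thesis using m S(1) by (simp add: card_cartesian_product)
qed simp

end

text \<open>The first alternative covers graphs with fewer than \<open>4 * card (S + T)\<close>
  edges, the second those to which the crossing inequality applies.\<close>

theorem translates_of_curve_sumset:
  fixes J :: "real set" and \<phi> :: "real \<Rightarrow> real" and S T :: "(real \<times> real) set"
  assumes J: "is_interval J" "continuous_on J \<phi>"
    and once: "\<And>x y a b. \<lbrakk>x \<in> J; x - a \<in> J; y \<in> J; y - a \<in> J; \<phi> x = \<phi> (x - a) + b; \<phi> y = \<phi> (y - a) + b;
       (a, b) \<noteq> (0, 0)\<rbrakk> \<Longrightarrow> x = y"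
    and S: "finite S" "\<And>s. s \<in> S \<Longrightarrow> fst s \<in> J \<and> snd s = \<phi> (fst s)" "2 \<le> card S" and T: "finite T"
  shows "card S * card T \<le> 8 * card (S + T) \<or> card S ^ 3 * card T \<le> 512 * card (S + T) ^ 2"
proof (cases "T = {}")
  case False
  interpret curve_translates J \<phi> "S + T" T
    using assms by unfold_locales (auto simp: finite_set_plus)
  define n m N where "n = card S" and "m = card T" and "N = card (S + T)"
  have m: "m > 0" using False T by (simp add: m_def card_gt_0_iff)
  have "(n - 1) * m \<le> card E" unfolding n_def m_def using S by (intro card_edges_ge) auto
  \<comment> \<open>Here \<open>2 \<le> n\<close> enters. The factor 2 turns the 4 of the sparse
    case into 8, and its cube turns 64 into 512.\<close>
  moreover have "n * m \<le> 2 * ((n - 1) * m)"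
    unfolding mult.assoc[symmetric] using S(3) by (intro mult_right_mono) (auto simp: n_def)
  ultimately have e: "n * m \<le> 2 * card E" by linarith
  show ?thesis
  proof (cases "4 * N \<le> card E")
    case True
    have "(n * m) ^ 3 \<le> (2 * card E) ^ 3" using e by (rule power_mono) simp
    also have "\<dots> = 8 * card E ^ 3" by (simp add: power_mult_distrib)
    also have "\<dots> \<le> 8 * (64 * N ^ 2 * card crossings)"
      using crossing_inequality[OF crossing_ends_disjoint] True by (simp add: N_def)
    also have "\<dots> \<le> 8 * (64 * N ^ 2 * m ^ 2)"
      using card_crossings_le by (simp add: m_def)
    finally have "m ^ 2 * (n ^ 3 * m) \<le> m ^ 2 * (512 * N ^ 2)"
      by (simp add: power_mult_distrib power_numeral_reduce mult_ac)
    then show ?thesis using m by (simp add: n_def m_def N_def)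
  next
    case False
    then show ?thesis using e by (simp add: n_def m_def N_def)
  qed
qed simp

section \<open>Curves whose slope is injective\<close>

lemma inj_on_of_nonzero_derivative:
  fixes F :: "real \<Rightarrow> real"
  assumes I: "is_interval I"
    and F: "\<And>t. t \<in> I \<Longrightarrow> (F has_real_derivative F' t) (at t)" "\<And>t. t \<in> I \<Longrightarrow> F' t \<noteq> 0"
  shows "inj_on F I"
proof (rule linorder_inj_onI)
  fix s t assume st: "s < t" "s \<in> I" "t \<in> I"
  have sub: "{s..t} \<subseteq> I" using mem_is_interval_1_I[OF I st(2,3)] by auto
  show "F s \<noteq> F t"
  proof
    assume "F s = F t"
    moreover have "continuous_on {s..t} F"
      by (rule DERIV_continuous_on[OF has_field_derivative_at_within[OF F(1)]]) (use sub in blast)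
    moreover have "(F has_derivative (*) (F' x)) (at x)" if "s < x" "x < t" for x
    proof -
      have "x \<in> I" using sub that by (simp add: subset_iff)
      then show ?thesis using F(1) by (simp add: has_field_derivative_def)
    qed
    ultimately obtain z where z: "s < z" "z < t" "(*) (F' z) = (\<lambda>v. 0)"
      using Rolle_deriv[OF st(1), of F "\<lambda>x. (*) (F' x)"] by blast
    then have "F' z * 1 = 0" by (intro fun_cong[OF z(3)])
    moreover have "z \<in> I" using z(1,2) sub by (simp add: subset_iff)
    ultimately show False using F(2)[of z] by simp
  qed
qed auto

text \<open>Both \<open>x\<close> and \<open>y\<close> solve
  \<open>\<phi> x - \<phi> (x - a) = b\<close>, and the left side has derivative
  \<open>\<phi>' x - \<phi>' (x - a)\<close>, which is nonzero for \<open>a \<noteq> 0\<close> as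
  \<open>\<phi>'\<close> is injective.\<close>

lemma translates_meet_once_of_inj_derivative:
  fixes \<phi> :: "real \<Rightarrow> real"
  assumes J: "is_interval J"
    and \<phi>: "\<And>x. x \<in> J \<Longrightarrow> (\<phi> has_real_derivative \<phi>' x) (at x)" "inj_on \<phi>' J"
    and x: "x \<in> J" "x - a \<in> J" "\<phi> x = \<phi> (x - a) + b"
    and y: "y \<in> J" "y - a \<in> J" "\<phi> y = \<phi> (y - a) + b"
    and ab: "(a, b) \<noteq> (0, 0)"
  shows "x = y"
proof -
  have a: "a \<noteq> 0" using ab x by auto
  define I where "I = J \<inter> (+) a ` J"
  have "is_interval I"
    using J unfolding I_def by (intro is_interval_Int) auto
  moreover have "((\<lambda>x. \<phi> x - \<phi> (x - a)) has_real_derivative \<phi>' t - \<phi>' (t - a)) (at t)"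
    "\<phi>' t - \<phi>' (t - a) \<noteq> 0" if "t \<in> I" for t
  proof -
    have t: "t \<in> J" "t - a \<in> J" using that by (auto simp: I_def)
    have "((\<lambda>x. x - a) has_real_derivative 1) (at t)" by (auto intro!: derivative_eq_intros)
    with \<phi>(1)[OF t(2)] have "((\<lambda>x. \<phi> (x - a)) has_real_derivative \<phi>' (t - a) * 1) (at t)"
      by (rule DERIV_chain2[where g = "\<lambda>x. x - a"])
    then have "((\<lambda>x. \<phi> (x - a)) has_real_derivative \<phi>' (t - a)) (at t)" by simp
    then show "((\<lambda>x. \<phi> x - \<phi> (x - a)) has_real_derivative \<phi>' t - \<phi>' (t - a)) (at t)"
      by (intro DERIV_diff \<phi>(1) t)
    show "\<phi>' t - \<phi>' (t - a) \<noteq> 0" using inj_onD[OF \<phi>(2) _ t] a by auto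
  qed
  ultimately have "inj_on (\<lambda>x. \<phi> x - \<phi> (x - a)) I" by (rule inj_on_of_nonzero_derivative)
  moreover have "x \<in> I" "y \<in> I" using x y by (force simp: I_def)+
  moreover have "\<phi> x - \<phi> (x - a) = \<phi> y - \<phi> (y - a)" using x(3) y(3) by linarith
  ultimately show ?thesis by (blast dest: inj_onD)
qed

text \<open>With \<open>X\<close> as the new parameter the curve becomes the graph of
  \<open>Y\<close> composed with the inverse of \<open>X\<close>. Its derivative is the slope
  \<open>Y' / X'\<close>, which is injective because \<open>D\<close> does not vanish.\<close>

theorem parametrized_curve_sumset:
  fixes X Y :: "real \<Rightarrow> real" and T :: "(real \<times> real) set"
  assumes I: "is_interval I" "open I"
    and X: "\<And>t. t \<in> I \<Longrightarrow> (X has_real_derivative X' t) (at t)" "\<And>t. t \<in> I \<Longrightarrow> X' t \<noteq> 0"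
    and Y: "\<And>t. t \<in> I \<Longrightarrow> (Y has_real_derivative Y' t) (at t)"
    and slope: "\<And>t. t \<in> I \<Longrightarrow> ((\<lambda>t. Y' t / X' t) has_real_derivative D t) (at t)"
      "\<And>t. t \<in> I \<Longrightarrow> D t \<noteq> 0"
    and B: "finite B" "B \<subseteq> I" "2 \<le> card B" and T: "finite T"
  defines "S \<equiv> (\<lambda>t. (X t, Y t)) ` B"
  shows "card B * card T \<le> 8 * card (S + T) \<or> card B ^ 3 * card T \<le> 512 * card (S + T) ^ 2"
proof -
  have injX: "inj_on X I" using I(1) X by (rule inj_on_of_nonzero_derivative)
  have injR: "inj_on (\<lambda>t. Y' t / X' t) I" using I(1) slope by (rule inj_on_of_nonzero_derivative)
  have contX: "continuous_on I X" by (rule DERIV_continuous_on[OF has_field_derivative_at_within[OF X(1)]])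
  define G where "G = inv_into I X"
  have G: "G (X t) = t" if "t \<in> I" for t using injX that by (simp add: G_def)
  define \<phi> \<phi>' where "\<phi> = (\<lambda>x. Y (G x))" and "\<phi>' = (\<lambda>x. Y' (G x) / X' (G x))"
  have interval: "is_interval (X ` I)"
    using connected_continuous_image[OF contX] I(1) by (simp add: is_interval_connected_1)
  have deriv: "(\<phi> has_real_derivative \<phi>' x) (at x)" if x: "x \<in> X ` I" for x
  proof -
    obtain t where t: "t \<in> I" "x = X t" using x by auto
    \<comment> \<open>The inverse function theorem, for which \<open>I\<close> has to be
      open.\<close>
    have "(G has_derivative (*) (inverse (X' t))) (at (X t))"
    proof (rule has_derivative_inverse_strong[OF I(2) t(1) contX G])
      show "(X has_derivative (*) (X' t)) (at t)"
        using X(1)[OF t(1)] by (simp add: has_field_derivative_def)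
      show "(*) (X' t) \<circ> (*) (inverse (X' t)) = id" using X(2)[OF t(1)] by (auto simp: fun_eq_iff)
    qed
    then have "(G has_real_derivative inverse (X' t)) (at (X t))"
      by (simp add: has_field_derivative_def)
    moreover have "(Y has_real_derivative Y' t) (at (G (X t)))" using Y t G by simp
    ultimately have "(\<phi> has_real_derivative Y' t * inverse (X' t)) (at (X t))"
      unfolding \<phi>_def by (rule DERIV_chain2[rotated])
    then show ?thesis using t G by (simp add: \<phi>'_def divide_inverse)
  qed
  have inj: "inj_on \<phi>' (X ` I)"
  proof (rule inj_onI)
    fix x y assume "x \<in> X ` I" "y \<in> X ` I" "\<phi>' x = \<phi>' y"
    then obtain s t where "s \<in> I" "t \<in> I" "x = X s" "y = X t" "Y' s / X' s = Y' t / X' t"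
      by (auto simp: \<phi>'_def G)
    then show "x = y" using inj_onD[OF injR, of s t] by simp
  qed
  have cardS: "card S = card B"
    unfolding S_def using inj_on_subset[OF injX B(2)] by (intro card_image) (auto simp: inj_on_def)
  have "continuous_on (X ` I) \<phi>"
    by (rule DERIV_continuous_on[OF has_field_derivative_at_within[OF deriv]])
  moreover have "fst s \<in> X ` I \<and> snd s = \<phi> (fst s)" if "s \<in> S" for s
    using that B(2) G by (auto simp: S_def \<phi>_def)
  moreover have "finite S" using B by (simp add: S_def)
  ultimately have "card S * card T \<le> 8 * card (S + T) \<or> card S ^ 3 * card T \<le> 512 * card (S + T) ^ 2"
    using translates_meet_once_of_inj_derivative[OF interval deriv inj] interval B T cardS
    by (intro translates_of_curve_sumset[of "X ` I" \<phi>]) (assumption | simp)+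
  then show ?thesis by (simp add: cardS)
qed

section \<open>Polynomials with proportional logarithmic derivatives\<close>

lemma lead_coeff_pderiv_real:
  fixes p :: "real poly"
  shows "lead_coeff (pderiv p) = real (degree p) * lead_coeff p"
proof (cases "degree p")
  case 0
  then show ?thesis using pderiv_eq_0_iff[of p] by simp
next
  case (Suc n)
  then show ?thesis by (simp add: degree_pderiv coeff_pderiv)
qed

text \<open>The hypothesis says \<open>q'/q = c * p'/p\<close> without division; comparing leading
  coefficients gives the claim.\<close>

lemma degree_of_log_derivative_ratio:
  fixes p q :: "real poly"
  assumes "p \<noteq> 0" "q \<noteq> 0" and eq: "pderiv q * p = smult c (q * pderiv p)"
  shows "real (degree q) = c * real (degree p)"
proof -
  have "lead_coeff (pderiv q * p) = lead_coeff (smult c (q * pderiv p))" by (simp only: eq)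
  then have "real (degree q) * (lead_coeff q * lead_coeff p) = c * real (degree p) * (lead_coeff q * lead_coeff p)"
    unfolding lead_coeff_mult lead_coeff_smult lead_coeff_pderiv_real by (simp add: mult_ac)
  then show ?thesis using assms by simp
qed

text \<open>Subtracting the multiple of \<open>v\<close> with the same leading coefficient keeps the
  Wronskian zero. A nonzero remainder would have the degree of \<open>v\<close>, yet its coefficient
  there has been cancelled.\<close>

lemma zero_wronskian_imp_proportional:
  fixes u v :: "real poly"
  assumes v: "v \<noteq> 0" and W: "pderiv u * v = u * pderiv v"
  shows "\<exists>c. u = smult c v"
proof (cases "u = 0")
  case True
  then show ?thesis by (intro exI[of _ 0]) simp
next
  case False
  define c r where "c = lead_coeff u / lead_coeff v" and "r = u - smult c v"
  have deg: "degree u = degree v"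
    using degree_of_log_derivative_ratio[OF v False, of 1] W by simp
  have "r = 0"
  proof (rule ccontr)
    assume r: "r \<noteq> 0"
    have "pderiv r * v = r * pderiv v"
      using W by (simp add: r_def pderiv_diff pderiv_smult algebra_simps)
    then have "degree r = degree v" using degree_of_log_derivative_ratio[OF v r, of 1] by simp
    moreover have "coeff r (degree v) = 0" using deg v by (simp add: r_def c_def)
    ultimately show False using r leading_coeff_0_iff[of r] by simp
  qed
  then show ?thesis by (auto simp: r_def)
qed

section \<open>Polynomial and logarithmic curves\<close>

text \<open>
  For the logarithm, \<open>coord\<close> is \<open>log |x|\<close> written as \<open>ln (x\<^sup>2) / 2\<close>, which is easier to differentiate;
  the coordinate is defined, and has derivative \<open>p' / coord_denom f p\<close>, where \<open>coord_denom f p\<close>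
  does not vanish.
\<close>

definition coord :: "(real \<rightharpoonup> real) \<Rightarrow> real \<Rightarrow> real" where
  "coord f y = (if f = log_abs then ln (y\<^sup>2) / 2 else y)"

definition coord_denom :: "(real \<rightharpoonup> real) \<Rightarrow> real poly \<Rightarrow> real poly" where
  "coord_denom f p = (if f = log_abs then p else 1)"

lemma log_abs_neq_Some: "log_abs \<noteq> Some"
  by (metis log_abs_def option.distinct(1))

lemma coord_eq_Some_iff:
  assumes "f \<in> {log_abs, Some}"
  shows "f (poly p t) = Some x \<longleftrightarrow> poly (coord_denom f p) t \<noteq> 0 \<and> x = coord f (poly p t)"
proof -
  have ln_abs: "ln \<bar>y\<bar> = ln (y\<^sup>2) / 2" if "y \<noteq> 0" for y :: real
  proof -
    have "ln (y\<^sup>2) = ln (\<bar>y\<bar>\<^sup>2)" by simp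
    also have "\<dots> = 2 * ln \<bar>y\<bar>" using that by (subst ln_realpow) auto
    finally show ?thesis by simp
  qed
  then show ?thesis
    using assms log_abs_neq_Some by (auto simp: coord_def coord_denom_def log_abs_def ln_abs)
qed

lemma coord_has_derivative:
  assumes "poly (coord_denom f p) t \<noteq> 0"
  shows "((\<lambda>t. coord f (poly p t)) has_real_derivative
     poly (pderiv p) t / poly (coord_denom f p) t) (at t)"
proof (cases "f = log_abs")
  case True
  then have "poly p t \<noteq> 0" using assms by (simp add: coord_denom_def)
  moreover from this have "(poly p t)\<^sup>2 > 0" by simp
  ultimately show ?thesis using True
    by (auto simp: coord_def coord_denom_def power2_eq_square field_simps
        intro!: derivative_eq_intros poly_DERIV)
next
  case False
  then show ?thesis by (simp add: coord_def coord_denom_def poly_DERIV)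
qed

lemma in_affine_lineI:
  assumes "(\<alpha>, \<beta>) \<noteq> (0, 0)" "\<And>x y. (x, y) \<in> X \<Longrightarrow> \<alpha> * x + \<beta> * y = \<gamma>"
  shows "in_affine_line X"
  unfolding in_affine_line_def
proof (intro exI conjI)
  let ?L = "{z. (\<alpha>, \<beta>) \<bullet> z = \<gamma>}"
  show "affine ?L" by (rule affine_hyperplane)
  show "aff_dim ?L = 1" using assms(1) by (subst aff_dim_hyperplane) (auto simp: zero_prod_def)
  show "X \<subseteq> ?L" using assms(2) by auto
qed

lemma poly_of_pderiv_0: "pderiv q = 0 \<Longrightarrow> poly q t = coeff q 0" for q :: "real poly"
  using pderiv_iszero[of q] by auto

text \<open>Comparing degrees shows that \<open>c\<close> is the rational number
  \<open>a / b\<close>. Hence \<open>q ^ b\<close> and \<open>p ^ a\<close> have the same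
  logarithmic derivative and are proportional; taking logarithms of squares gives the line.\<close>

lemma log_log_in_line:
  fixes p q :: "real poly"
  assumes p: "pderiv p \<noteq> 0" and q: "q \<noteq> 0" and eq: "pderiv q * p = smult c (q * pderiv p)"
  shows "\<exists>k a b. b > 0 \<and> (\<forall>t. poly p t \<noteq> 0 \<longrightarrow> poly q t \<noteq> 0 \<longrightarrow>
    real b * ln ((poly q t)\<^sup>2) = k + real a * ln ((poly p t)\<^sup>2))"
proof -
  define a b where "a = degree q" and "b = degree p"
  have p0: "p \<noteq> 0" and b: "b > 0" using p by (auto simp: b_def pderiv_eq_0_iff)
  have a: "real a = c * real b"
    using degree_of_log_derivative_ratio[OF p0 q eq] by (simp add: a_def b_def)
  have "pderiv (q ^ b) * p ^ a = q ^ b * pderiv (p ^ a)"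
  proof -
    \<comment> \<open>The factor \<open>p * q\<close>, cancelled at the end, makes \<open>eq\<close>
      applicable without dividing polynomials.\<close>
    have "(pderiv (q ^ b) * p ^ a) * (p * q) = smult (real b) (q ^ (b - 1) * q * p ^ a * (pderiv q * p))"
      by (simp add: pderiv_power mult_ac)
    also have "\<dots> = smult (real b * c) (q ^ (b - 1) * q * p ^ a * (q * pderiv p))"
      by (simp add: eq)
    also have "\<dots> = smult (real b * c) (q ^ b * p ^ a * (q * pderiv p))"
      using b by (simp only: power_minus_mult)
    also have "\<dots> = smult (real a) (q ^ b * p ^ a * (q * pderiv p))" by (simp add: a mult_ac)
    also have "\<dots> = (q ^ b * pderiv (p ^ a)) * (p * q)"
    proof (cases a)
      case (Suc n)
      show ?thesis unfolding Suc pderiv_power_Suc by (simp add: mult_ac)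
    qed simp
    finally show ?thesis using p0 q by simp
  qed
  then obtain k where k: "q ^ b = smult k (p ^ a)"
    using zero_wronskian_imp_proportional[of "p ^ a" "q ^ b"] p0 by auto
  then have k0: "k \<noteq> 0" using q by auto
  have "real b * ln ((poly q t)\<^sup>2) = ln (k\<^sup>2) + real a * ln ((poly p t)\<^sup>2)"
    if "poly p t \<noteq> 0" "poly q t \<noteq> 0" for t
  proof -
    have "poly q t ^ b = k * poly p t ^ a" using k by (metis poly_power poly_smult)
    then have "((poly q t)\<^sup>2) ^ b = k\<^sup>2 * ((poly p t)\<^sup>2) ^ a"
      by (metis power_commutes power_mult power_mult_distrib mult.commute)
    then have "ln (((poly q t)\<^sup>2) ^ b) = ln (k\<^sup>2 * ((poly p t)\<^sup>2) ^ a)" by simp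
    then show ?thesis using that k0 by (simp add: ln_mult ln_realpow)
  qed
  then show ?thesis using b by blast
qed

text \<open>The hypothesis states that the slope is the constant \<open>c\<close>. Two logarithms
  give \<open>log_log_in_line\<close>, two identities make \<open>q - c p\<close> constant, and in
  the mixed cases degrees force \<open>q\<close> to be constant.\<close>

lemma in_affine_line_of_constant_slope:
  assumes f: "f \<in> {log_abs, Some}" and g: "g \<in> {log_abs, Some}"
    and p: "pderiv p \<noteq> 0" and q: "coord_denom g q \<noteq> 0"
    and eq: "pderiv q * coord_denom f p = smult c (coord_denom g q * pderiv p)"
  shows "in_affine_line (poly_points f g p q UNIV)"
proof -
  have pts: "\<exists>t. poly (coord_denom f p) t \<noteq> 0 \<and> poly (coord_denom g q) t \<noteq> 0 \<and>
      x = coord f (poly p t) \<and> y = coord g (poly q t)"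
    if "(x, y) \<in> poly_points f g p q UNIV" for x y
    using that coord_eq_Some_iff[OF f] coord_eq_Some_iff[OF g] by (auto simp: poly_points_def)
  have horizontal: ?thesis if "pderiv q = 0"
  proof (rule in_affine_lineI)
    show "(0, 1) \<noteq> (0 :: real, 0 :: real)" by simp
    show "0 * x + 1 * y = coord g (coeff q 0)" if "(x, y) \<in> poly_points f g p q UNIV" for x y
      using pts[OF that] poly_of_pderiv_0[OF \<open>pderiv q = 0\<close>] by auto
  qed
  have degp: "degree p > 0" using p by (simp add: pderiv_eq_0_iff)
  consider (log_log) "f = log_abs" "g = log_abs" | (id_log) "f \<noteq> log_abs" "g = log_abs"
    | (log_id) "f = log_abs" "g \<noteq> log_abs" | (id_id) "f \<noteq> log_abs" "g \<noteq> log_abs"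
    by blast
  then show ?thesis
  proof cases
    case log_log
    then have "q \<noteq> 0" "pderiv q * p = smult c (q * pderiv p)"
      using q eq by (simp_all add: coord_denom_def)
    then obtain k a b where b: "b > 0" and
      k: "\<And>t. poly p t \<noteq> 0 \<Longrightarrow> poly q t \<noteq> 0 \<Longrightarrow>
        real b * ln ((poly q t)\<^sup>2) = k + real a * ln ((poly p t)\<^sup>2)"
      using log_log_in_line[OF p] by metis
    show ?thesis
    proof (rule in_affine_lineI)
      show "(- real a, real b) \<noteq> (0, 0)" using b by simp
      show "- real a * x + real b * y = k / 2" if xy: "(x, y) \<in> poly_points f g p q UNIV" for x y
      proof -
        obtain t where "poly p t \<noteq> 0" "poly q t \<noteq> 0"
            "ln ((poly p t)\<^sup>2) = 2 * x" "ln ((poly q t)\<^sup>2) = 2 * y"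
          using pts[OF xy] log_log by (auto simp: coord_def coord_denom_def)
        then have "real b * (2 * y) = k + real a * (2 * x)" using k by metis
        then show ?thesis by (simp add: algebra_simps)
      qed
    qed
  next
    case id_log
    then have q0: "q \<noteq> 0" and e: "pderiv q = smult c (q * pderiv p)"
      using q eq by (simp_all add: coord_denom_def)
    \<comment> \<open>Otherwise \<open>pderiv q\<close> would have at least the degree of
      \<open>q\<close>, which is possible only for constant \<open>q\<close>; then its derivative is
      0, whereas the right side of \<open>e\<close> is not.\<close>
    have "c = 0"
    proof (rule ccontr)
      assume c: "c \<noteq> 0"
      then have "degree (pderiv q) = degree q + degree (pderiv p)"
        using e q0 p by (simp add: degree_mult_eq)
      then have "degree q = 0" by (simp add: degree_pderiv)
      then have "pderiv q = 0" by (simp add: pderiv_eq_0_iff)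
      then show False using e c q0 p by simp
    qed
    then show ?thesis using e horizontal by simp
  next
    case log_id
    then have e: "pderiv q * p = smult c (pderiv p)"
      using eq by (simp add: coord_denom_def)
    have "pderiv q = 0"
    proof (rule ccontr)
      assume q: "pderiv q \<noteq> 0"
      have "p \<noteq> 0" using p by auto
      then have "degree (pderiv q) + degree p = degree (smult c (pderiv p))"
        using q by (simp add: degree_mult_eq flip: e)
      also have "\<dots> \<le> degree (pderiv p)" by (rule degree_smult_le)
      finally show False using degp by (simp add: degree_pderiv)
    qed
    then show ?thesis by (rule horizontal)
  next
    case id_id
    then have "pderiv (q - smult c p) = 0"
      using eq by (simp add: coord_denom_def pderiv_diff pderiv_smult)
    then have k: "poly q t - c * poly p t = coeff (q - smult c p) 0" for t
      using poly_of_pderiv_0[of "q - smult c p" t] by simp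
    show ?thesis
    proof (rule in_affine_lineI)
      show "(- c, 1) \<noteq> (0, 0 :: real)" by simp
      show "- c * x + 1 * y = coeff (q - smult c p) 0" if "(x, y) \<in> poly_points f g p q UNIV" for x y
        using pts[OF that] k id_id by (auto simp: coord_def)
    qed
  qed
qed

text \<open>The slope of the curve is \<open>u / v\<close>, and the Wronskian is the numerator of its derivative.\<close>

definition slope_wronskian where
  "slope_wronskian f g p q = (let u = pderiv q * coord_denom f p; v = coord_denom g q * pderiv p
     in pderiv u * v - u * pderiv v)"

text \<open>The factors vanish, in turn, where a coordinate is undefined, where the first coordinate
  is stationary, and where the slope is stationary.\<close>

definition exceptional where
  "exceptional f g p q = coord_denom f p * coord_denom g q * pderiv p * slope_wronskian f g p q"

text \<open>A vanishing factor would put the curve in a line: constant \<open>p\<close> gives a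
  vertical one, and zero Wronskian means constant slope.\<close>

lemma exceptional_nonzero:
  assumes f: "f \<in> {log_abs, Some}" and g: "g \<in> {log_abs, Some}"
    and nl: "\<not> in_affine_line (poly_points f g p q UNIV)"
  shows "exceptional f g p q \<noteq> 0"
proof -
  have pts: "\<exists>t. poly (coord_denom f p) t \<noteq> 0 \<and> poly (coord_denom g q) t \<noteq> 0 \<and> x = coord f (poly p t)"
    if "(x, y) \<in> poly_points f g p q UNIV" for x y
    using that coord_eq_Some_iff[OF f] coord_eq_Some_iff[OF g] by (auto simp: poly_points_def)
  have p: "pderiv p \<noteq> 0"
  proof
    assume "pderiv p = 0"
    have "in_affine_line (poly_points f g p q UNIV)"
    proof (rule in_affine_lineI)
      show "(1, 0) \<noteq> (0 :: real, 0 :: real)" by simp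
      show "1 * x + 0 * y = coord f (coeff p 0)" if "(x, y) \<in> poly_points f g p q UNIV" for x y
        using pts[OF that] poly_of_pderiv_0[OF \<open>pderiv p = 0\<close>] by auto
    qed
    then show False using nl by simp
  qed
  have "coord_denom f p \<noteq> 0" using p by (auto simp: coord_denom_def)
  \<comment> \<open>If it were 0, the second coordinate would be defined nowhere, and the empty
    curve lies in any line.\<close>
  moreover have q: "coord_denom g q \<noteq> 0"
  proof
    assume "coord_denom g q = 0"
    then have "in_affine_line (poly_points f g p q UNIV)"
      using pts by (intro in_affine_lineI[of 1 0 _ 0]) fastforce+
    then show False using nl by simp
  qed
  moreover have "slope_wronskian f g p q \<noteq> 0"
  proof
    assume "slope_wronskian f g p q = 0"
    then obtain c where "pderiv q * coord_denom f p = smult c (coord_denom g q * pderiv p)"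
      using zero_wronskian_imp_proportional[of "coord_denom g q * pderiv p" "pderiv q * coord_denom f p"] p q
      by (auto simp: slope_wronskian_def Let_def)
    then show False using in_affine_line_of_constant_slope[OF f g p q] nl by blast
  qed
  ultimately show ?thesis using p by (simp add: exceptional_def)
qed

text \<open>The three simple factors contribute \<open>\<delta>\<close> each and the Wronskian of
  \<open>u\<close> and \<open>v\<close>, both of degree at most \<open>2 * \<delta>\<close>,
  contributes \<open>4 * \<delta>\<close>.\<close>

lemma degree_exceptional_le:
  assumes "degree p \<le> \<delta>" "degree q \<le> \<delta>"
  shows "degree (exceptional f g p q) \<le> 7 * \<delta>"
proof -
  define u v where "u = pderiv q * coord_denom f p" and "v = coord_denom g q * pderiv p"
  have d: "degree (coord_denom f p) \<le> \<delta>" "degree (coord_denom g q) \<le> \<delta>"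
    "degree (pderiv p) \<le> \<delta>" "degree (pderiv q) \<le> \<delta>"
    using assms by (auto simp: coord_denom_def degree_pderiv)
  have uv: "degree u \<le> 2 * \<delta>" "degree v \<le> 2 * \<delta>"
    unfolding u_def v_def
    by (rule order.trans[OF degree_mult_le]; use d in simp)+
  have "degree (pderiv u * v) \<le> 4 * \<delta>" "degree (u * pderiv v) \<le> 4 * \<delta>"
    by (rule order.trans[OF degree_mult_le]; use uv degree_pderiv[of u] degree_pderiv[of v] in linarith)+
  then have W: "degree (slope_wronskian f g p q) \<le> 4 * \<delta>"
    unfolding slope_wronskian_def Let_def u_def[symmetric] v_def[symmetric] by (rule degree_diff_le)
  have "degree (coord_denom f p * coord_denom g q) \<le> 2 * \<delta>"
    by (rule order.trans[OF degree_mult_le]; use d in simp)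
  then have "degree (coord_denom f p * coord_denom g q * pderiv p) \<le> 3 * \<delta>"
    by (intro order.trans[OF degree_mult_le]) (use d in simp)
  then show ?thesis
    unfolding exceptional_def by (intro order.trans[OF degree_mult_le]) (use W in simp)
qed

lemma regular_piece_sumset:
  assumes I: "is_interval I" "open I" "\<And>t. t \<in> I \<Longrightarrow> poly (exceptional f g p q) t \<noteq> 0"
    and B: "finite B" "B \<subseteq> I" "2 \<le> card B" and T: "finite T"
  defines "S \<equiv> (\<lambda>t. (coord f (poly p t), coord g (poly q t))) ` B"
  shows "card B * card T \<le> 8 * card (S + T) \<or> card B ^ 3 * card T \<le> 512 * card (S + T) ^ 2"
proof -
  define X' Y' where "X' = (\<lambda>t. poly (pderiv p) t / poly (coord_denom f p) t)"
    and "Y' = (\<lambda>t. poly (pderiv q) t / poly (coord_denom g q) t)"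
  define u v where "u = pderiv q * coord_denom f p" and "v = coord_denom g q * pderiv p"
  define D where "D = (\<lambda>t. poly (slope_wronskian f g p q) t / (poly v t)\<^sup>2)"
  have nz: "poly (coord_denom f p) t \<noteq> 0" "poly (coord_denom g q) t \<noteq> 0"
    "poly (pderiv p) t \<noteq> 0" "poly (slope_wronskian f g p q) t \<noteq> 0" if "t \<in> I" for t
    using I(3)[OF that] by (auto simp: exceptional_def)
  have slope: "((\<lambda>t. Y' t / X' t) has_real_derivative D t) (at t)" if t: "t \<in> I" for t
  proof -
    have "poly v t \<noteq> 0" using nz[OF t] by (simp add: v_def)
    then have "((\<lambda>t. poly u t / poly v t) has_real_derivative
        (poly (pderiv u) t * poly v t - poly u t * poly (pderiv v) t) / (poly v t * poly v t)) (at t)"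
      by (intro DERIV_divide poly_DERIV)
    then have "((\<lambda>t. poly u t / poly v t) has_real_derivative D t) (at t)"
      by (simp add: D_def slope_wronskian_def Let_def u_def[symmetric] v_def[symmetric] power2_eq_square)
    then show ?thesis
    \<comment> \<open>The quotients \<open>u / v\<close> and \<open>Y' / X'\<close> are known to
      agree on \<open>I\<close>, where no denominator vanishes; openness of \<open>I\<close>
      suffices to transfer the derivative.\<close>
    proof (rule has_field_derivative_transform_within_open[OF _ I(2) t])
      fix s assume "s \<in> I"
      then show "poly u s / poly v s = Y' s / X' s"
        using nz[of s] by (simp add: u_def v_def X'_def Y'_def)
    qed
  qed
  show ?thesis
    unfolding S_def
  proof (rule parametrized_curve_sumset[OF I(1,2) _ _ _ slope _ B T])
    fix t assume t: "t \<in> I"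
    show "((\<lambda>t. coord f (poly p t)) has_real_derivative X' t) (at t)"
      "((\<lambda>t. coord g (poly q t)) has_real_derivative Y' t) (at t)"
      using nz[OF t] by (auto simp: X'_def Y'_def intro: coord_has_derivative)
    show "X' t \<noteq> 0" "D t \<noteq> 0" using nz[OF t] by (auto simp: X'_def D_def v_def)
  qed
qed

section \<open>Cutting the parameter line at the exceptional zeros\<close>

text \<open>For finite \<open>Z\<close>, the gaps between its points, indexed by the set
  \<open>C\<close> of points to the left. A subset of \<open>Z\<close> that is not an initial
  segment gives an empty piece; admitting all subsets spares an enumeration of \<open>Z\<close> and
  only worsens the constant.\<close>

definition piece :: "real set \<Rightarrow> real set \<Rightarrow> real set" where
  "piece Z C = {t. (\<forall>z\<in>C. z < t) \<and> (\<forall>z\<in>Z - C. t < z)}"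

lemma piece_interval: "is_interval (piece Z C)"
  unfolding piece_def is_interval_1 by (auto intro: less_le_trans le_less_trans)

lemma piece_open:
  assumes "finite Z" "C \<subseteq> Z"
  shows "open (piece Z C)"
proof -
  have "piece Z C = (\<Inter>z\<in>C. {z<..}) \<inter> (\<Inter>z\<in>Z - C. {..<z})"
    by (auto simp: piece_def)
  moreover have "finite C" using assms finite_subset by blast
  ultimately show ?thesis using assms by (auto intro!: open_Int open_INT)
qed

text \<open>Pigeonhole over the at most \<open>2 ^ M\<close> pieces, after setting aside the points
  of \<open>A\<close> that lie in \<open>Z\<close>.\<close>

lemma large_piece:
  assumes Z: "finite Z" "card Z \<le> M" and A: "finite A" "2 * 2 ^ M < card A"
  obtains C where "C \<subseteq> Z" "card A \<le> 2 * 2 ^ M * card (A \<inter> piece Z C)"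
proof -
  define n where "n = Max ((\<lambda>C. card (A \<inter> piece Z C)) ` Pow Z)"
  have le: "card (A \<inter> piece Z C) \<le> n" if "C \<subseteq> Z" for C
    unfolding n_def by (rule Max_ge) (use that Z(1) in blast)+
  have "n \<in> (\<lambda>C. card (A \<inter> piece Z C)) ` Pow Z"
    unfolding n_def by (rule Max_in) (use Z(1) in blast)+
  then obtain C where C: "C \<subseteq> Z" "n = card (A \<inter> piece Z C)" by auto
  have "A \<subseteq> Z \<union> (\<Union>C\<in>Pow Z. A \<inter> piece Z C)"
  proof
    fix t assume t: "t \<in> A"
    show "t \<in> Z \<union> (\<Union>C\<in>Pow Z. A \<inter> piece Z C)"
    proof (cases "t \<in> Z")
      case False
      then have "t \<in> piece Z {z \<in> Z. z < t}" by (auto simp: piece_def) (metis linorder_neqE)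
      then show ?thesis using t by (intro UnI2 UN_I[of "{z \<in> Z. z < t}"]) auto
    qed simp
  qed
  then have "card A \<le> card (Z \<union> (\<Union>C\<in>Pow Z. A \<inter> piece Z C))"
    by (rule card_mono[rotated]) (simp add: Z A)
  also have "\<dots> \<le> card Z + card (\<Union>C\<in>Pow Z. A \<inter> piece Z C)" by (rule card_Un_le)
  also have "card (\<Union>C\<in>Pow Z. A \<inter> piece Z C) \<le> (\<Sum>C\<in>Pow Z. card (A \<inter> piece Z C))"
    using Z(1) by (intro card_UN_le) simp
  also have "\<dots> \<le> of_nat (card (Pow Z)) * n" by (rule sum_bounded_above) (use le in blast)
  also have "\<dots> = 2 ^ card Z * n" using Z(1) by (simp add: card_Pow)
  also have "\<dots> \<le> 2 ^ M * n" using Z by (intro mult_right_mono power_increasing) auto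
  finally have A_le: "card A \<le> card Z + 2 ^ M * n" by simp
  \<comment> \<open>Since \<open>A\<close> is large, this forces \<open>n \<ge> 1\<close>; then
    \<open>card Z\<close> is at most \<open>2 ^ M * n\<close>, which accounts for the extra factor
    2.\<close>
  have "card Z < 2 ^ M" using Z less_exp[of M] by linarith
  moreover from this have "n \<noteq> 0" using A_le A(2) by (intro notI) simp
  then have "2 ^ M * 1 \<le> 2 ^ M * n" by (intro mult_left_mono) auto
  ultimately have "card A \<le> 2 * 2 ^ M * n" using A_le by linarith
  then show ?thesis using that[OF C(1)] C(2) by simp
qed

section \<open>The sumset bound\<close>

lemma powr_three_halves_half:
  fixes x y :: real
  assumes "0 \<le> x" "0 \<le> y"
  shows "x powr (3/2) * y powr (1/2) = sqrt (x ^ 3 * y)"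
proof -
  have "x powr (3/2) = sqrt (x ^ 3)"
    using assms powr_powr[of x 3 "1/2"] by (cases "x = 0") (auto simp: powr_half_sqrt powr_numeral)
  then show ?thesis using assms by (simp add: powr_half_sqrt real_sqrt_mult)
qed

text \<open>The last premise excludes a nonempty \<open>A\<close> all of whose points are lost to
  undefined logarithms: then the sumset is empty, although the minimum is positive for nonempty
  \<open>T\<close>.\<close>

theorem theorem1p3:
  fixes \<delta> :: nat
  shows "\<exists>K>0. \<forall>(p :: real poly) (q :: real poly) (f :: real \<rightharpoonup> real) (g :: real \<rightharpoonup> real)
           (A :: real set) (T :: (real \<times> real) set).
           degree p \<le> \<delta> \<longrightarrow> degree q \<le> \<delta> \<longrightarrow>
           f \<in> {log_abs, Some} \<longrightarrow> g \<in> {log_abs, Some} \<longrightarrow>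
           finite A \<longrightarrow> finite T \<longrightarrow>
           \<not> in_affine_line (poly_points f g p q UNIV) \<longrightarrow>
           (A \<noteq> {} \<longrightarrow> poly_points f g p q A \<noteq> {}) \<longrightarrow>
           min (real (card A) * real (card T)) (real (card A) powr (3/2) * real (card T) powr (1/2))
             \<le> K * real (card (poly_points f g p q A + T))"
proof -
  \<comment> \<open>The loss factor of \<open>large_piece\<close> for at most
    \<open>7 * \<delta>\<close> exceptional zeros.\<close>
  define L :: nat where "L = 2 * 2 ^ (7 * \<delta>)"
  have L: "L \<ge> 1" by (simp add: L_def)
  have "min (real (card A) * real (card T)) (real (card A) powr (3/2) * real (card T) powr (1/2))
      \<le> 32 * real L ^ 2 * real (card (poly_points f g p q A + T))"
    if deg: "degree p \<le> \<delta>" "degree q \<le> \<delta>" and f: "f \<in> {log_abs, Some}" and g: "g \<in> {log_abs, Some}"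
      and A: "finite A" and T: "finite T" and nl: "\<not> in_affine_line (poly_points f g p q UNIV)"
      and ne: "A \<noteq> {} \<longrightarrow> poly_points f g p q A \<noteq> {}"
    for p q f g A and T :: "(real \<times> real) set"
  proof -
    define S where "S = poly_points f g p q A"
    define pt where "pt = (\<lambda>t. (coord f (poly p t), coord g (poly q t)))"
    define N where "N = card (S + T)"
    have pt: "pt t \<in> S" if "t \<in> A" "poly (coord_denom f p) t \<noteq> 0" "poly (coord_denom g q) t \<noteq> 0" for t
      using that coord_eq_Some_iff[OF f] coord_eq_Some_iff[OF g]
      by (auto simp: S_def poly_points_def pt_def)
    have "S \<subseteq> pt ` A"
      using coord_eq_Some_iff[OF f] coord_eq_Some_iff[OF g]
      by (auto simp: S_def poly_points_def pt_def)
    then have finS: "finite S" using A finite_surj by blast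
    then have finST: "finite (S + T)" using T by (simp add: finite_set_plus)
    have L2: "real L \<le> real L ^ 2" using L by (simp add: power2_eq_square)
    have bound: "card A * card T \<le> 8 * L * N \<or> card A ^ 3 * card T \<le> L ^ 3 * (512 * N ^ 2)"
    proof (cases "card A \<le> L")
      \<comment> \<open>For small \<open>A\<close> a single point \<open>s\<close> of
        \<open>S\<close> suffices: it gives \<open>card T \<le> N\<close>.\<close>
      case True
      show ?thesis
      proof (cases "A = {}")
        case False
        then obtain s where "s \<in> S" using ne by (auto simp: S_def)
        then have "(+) s ` T \<subseteq> S + T" by (auto simp: set_plus_def)
        then have "card T \<le> N"
          unfolding N_def using finST card_mono[of "S + T" "(+) s ` T"] by (simp add: card_image)
        then have "card A * card T \<le> L * N" using True by (intro mult_le_mono)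
        then show ?thesis by simp
      qed simp
    next
      case False
      define H where "H = exceptional f g p q"
      define Z where "Z = {t. poly H t = 0}"
      have H: "H \<noteq> 0" unfolding H_def using f g nl by (rule exceptional_nonzero)
      have finZ: "finite Z" unfolding Z_def using H by (rule poly_roots_finite)
      have "card Z \<le> 7 * \<delta>"
        unfolding Z_def using card_poly_roots_bound[OF H] degree_exceptional_le[OF deg, of f g]
        by (simp add: H_def)
      then obtain C where C: "C \<subseteq> Z" "card A \<le> L * card (A \<inter> piece Z C)"
        using large_piece[OF finZ _ A] False unfolding L_def by (metis not_le)
      define B where "B = A \<inter> piece Z C"
      have B: "finite B" "B \<subseteq> piece Z C" using A by (auto simp: B_def)
      \<comment> \<open>From \<open>L < card A \<le> L * card B\<close>.\<close>
      have "L * 1 < L * card B" using C(2) False unfolding B_def by linarith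
      then have card_B: "2 \<le> card B" by simp
      have reg: "poly H t \<noteq> 0" if "t \<in> piece Z C" for t
        using that C(1) by (force simp: piece_def Z_def)
      have "pt ` B \<subseteq> S"
        using reg pt by (auto simp: B_def H_def exceptional_def)
      then have "pt ` B + T \<subseteq> S + T" by (intro set_plus_mono2) auto
      then have N: "card (pt ` B + T) \<le> N" unfolding N_def using finST by (rule card_mono[rotated])
      have "card B * card T \<le> 8 * card (pt ` B + T) \<or> card B ^ 3 * card T \<le> 512 * card (pt ` B + T) ^ 2"
        unfolding pt_def
        by (rule regular_piece_sumset[OF piece_interval piece_open[OF finZ C(1)] _ B card_B T])
          (use reg in \<open>simp add: H_def\<close>)
      then show ?thesis
      proof
        assume "card B * card T \<le> 8 * card (pt ` B + T)"
        then have "L * (card B * card T) \<le> L * (8 * N)" using N by (intro mult_left_mono) auto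
        moreover have "card A * card T \<le> L * card B * card T"
          using C(2) by (intro mult_right_mono) (auto simp: B_def)
        ultimately have "card A * card T \<le> 8 * L * N" by linarith
        then show ?thesis ..
      next
        assume "card B ^ 3 * card T \<le> 512 * card (pt ` B + T) ^ 2"
        also have "\<dots> \<le> 512 * N ^ 2" using N by (intro mult_left_mono power_mono) auto
        finally have "L ^ 3 * (card B ^ 3 * card T) \<le> L ^ 3 * (512 * N ^ 2)" by (rule mult_left_mono) simp
        moreover have "card A ^ 3 * card T \<le> (L * card B) ^ 3 * card T"
          using C(2) by (intro mult_right_mono power_mono) (auto simp: B_def)
        ultimately have "card A ^ 3 * card T \<le> L ^ 3 * (512 * N ^ 2)"
          unfolding power_mult_distrib by linarith
        then show ?thesis ..
      qed
    qed
    have K0: "0 \<le> 32 * real L ^ 2 * real N" by simp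
    show ?thesis
      unfolding S_def[symmetric] N_def[symmetric]
      using bound
    proof (elim disjE)
      assume "card A * card T \<le> 8 * L * N"
      then have "real (card A) * real (card T) \<le> 8 * real L * real N"
        by (simp only: of_nat_mult of_nat_numeral flip: of_nat_le_iff[where 'a = real])
      also have "\<dots> \<le> 32 * real L ^ 2 * real N"
        by (rule mult_right_mono) (use L2 in linarith, simp)
      finally show "min (real (card A) * real (card T))
          (real (card A) powr (3/2) * real (card T) powr (1/2)) \<le> 32 * real L ^ 2 * real N"
        by (rule min.coboundedI1)
    next
      assume "card A ^ 3 * card T \<le> L ^ 3 * (512 * N ^ 2)"
      then have "real (card A) ^ 3 * real (card T) \<le> real L ^ 3 * (512 * real N ^ 2)"
        by (simp only: of_nat_mult of_nat_power of_nat_numeral flip: of_nat_le_iff[where 'a = real])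
      \<comment> \<open>Rounded up to a perfect square, whose root is the announced constant
        \<open>32 * L^2\<close> times \<open>N\<close>.\<close>
      also have "\<dots> \<le> real L ^ 4 * (1024 * real N ^ 2)"
        by (intro mult_mono power_increasing[of 3 4]) (use L in auto)
      also have "\<dots> = (32 * real L ^ 2 * real N) ^ 2" by (simp add: power2_eq_square power4_eq_xxxx)
      finally have "sqrt (real (card A) ^ 3 * real (card T)) \<le> 32 * real L ^ 2 * real N"
        by (intro real_le_lsqrt K0)
      then show "min (real (card A) * real (card T))
          (real (card A) powr (3/2) * real (card T) powr (1/2)) \<le> 32 * real L ^ 2 * real N"
        by (intro min.coboundedI2) (subst powr_three_halves_half, simp_all)
    qed
  qed
  then show ?thesis using L by (intro exI[of _ "32 * real L ^ 2"]) auto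
qed

end
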